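(* Let $X: M^m \to \mathbb{R}^{m+n}_{n}$ be an $m$-dimensional spacelike entire graph, let $z=\langle X, X \rangle$, and let $w$ be the $w$-function of $M^m$. Assume that the origin $o$ of $\mathbb{R}^{m+n}_n$ belongs to $M^m$. Then $$\limsup_{R\to\infty}R^{-2m}\int_{\{z\leq R^2\}\cap M^m}w<\infty.$$ Consequently, for every $\alpha>0$, $$\int_{M^m}we^{-\alpha z}<\infty.$$
   Context: $\mathbb{R}^{m+n}_n$ is the linear space $\mathbb{R}^{m+n}$ with the indefinite inner product $\langle a,b\rangle=\sum_{i=1}^m a_ib_i-\sum_{\alpha=m+1}^{m+n}a_\alpha b_\alpha$. An $m$-dimensional submanifold $M^m$ (smooth, with position vector $X$) is spacelike if the induced metric is Riemannian. It is an entire graph if $M^m=\{(x,u(x)) : x\in\mathbb{R}^m\}$ for a smooth map $u=(u^1,\dots,u^n):\mathbb{R}^m\to\mathbb{R}^n$. Integrals over subsets of $M^m$ are with respect to the Riemannian volume of the induced metric. The $w$-function: fix a spacelike $m$-plane $P_2$ through the origin in $\mathbb{R}^{m+n}_n$ (an $m$-dimensional linear subspace on which $\langle\cdot,\cdot\rangle$ is positive definite) with an oriented orthonormal basis $a_1,\dots,a_m$. For a local oriented orthonormal frame $e_1,\dots,e_m$ of $TM^m$, set $w=\langle e_1\wedge\dots\wedge e_m,a_1\wedge\dots\wedge a_m\rangle=\det(\langle e_i,a_j\rangle)_{1\le i,j\le m}$, multiplied by $-1$ if necessary so that $w\ge1$ on $M^m$ (equivalently, $w=|\det(\langle e_i,a_j\rangle)|$).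 When $P_2=\mathbb{R}^m\times\{0\}$ one has $w=1/\sqrt{\det(g_{ij})}$ with $g_{ij}=\delta_{ij}-\sum_{\alpha}u^\alpha_iu^\alpha_j$, where $u^\alpha_i=\partial u^\alpha/\partial x_i$. *)

theory Defs
  imports "HOL-Analysis.Analysis"
begin

section \<open>The pseudo-Euclidean space of signature (m,n)\<close>

text \<open>
  The ambient space is \<open>real^'m \<times> real^'n\<close>, with \<open>m = CARD('m)\<close> and \<open>n = CARD('n)\<close>; its
  topology and Borel sets are the usual ones.
\<close>

type_synonym ('m, 'n) pseudo = "(real^'m) \<times> (real^'n)"

definition pinner :: "('m::finite, 'n::finite) pseudo \<Rightarrow> ('m, 'n) pseudo \<Rightarrow> real" where
  "pinner a b = (\<Sum>i\<in>UNIV. fst a $ i * fst b $ i) - (\<Sum>\<alpha>\<in>UNIV. snd a $ \<alpha> * snd b $ \<alpha>)"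

text \<open>
  The index type \<open>'m\<close> carries no order, so the bases below are not oriented. Orientation only
  affects the sign of the determinant in the \<open>w\<close>-function, where the absolute value is taken.
\<close>

definition orthonormal_basis ::
    "('m::finite, 'n::finite) pseudo set \<Rightarrow> ('m \<Rightarrow> ('m, 'n) pseudo) \<Rightarrow> bool" where
  "orthonormal_basis V e \<longleftrightarrow>
     span (range e) = V \<and> (\<forall>i j. pinner (e i) (e j) = (if i = j then 1 else 0))"

definition positive_definite_on :: "('m::finite, 'n::finite) pseudo set \<Rightarrow> bool" where
  "positive_definite_on V \<longleftrightarrow> (\<forall>v\<in>V. v \<noteq> 0 \<longrightarrow> pinner v v > 0)"

definition spacelike_plane :: "('m::finite, 'n::finite) pseudo set \<Rightarrow> bool" where
  "spacelike_plane P \<longleftrightarrow> subspace P \<and> dim P = CARD('m) \<and> positive_definite_on P"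


section \<open>Entire graphs\<close>

fun C_k :: "nat \<Rightarrow> ('a::euclidean_space \<Rightarrow> 'b::euclidean_space) \<Rightarrow> bool" where
  "C_k 0 f \<longleftrightarrow> continuous_on UNIV f"
| "C_k (Suc k) f \<longleftrightarrow>
     (\<forall>x. f differentiable (at x)) \<and> (\<forall>v. C_k k (\<lambda>x. frechet_derivative f (at x) v))"

definition smooth :: "('a::euclidean_space \<Rightarrow> 'b::euclidean_space) \<Rightarrow> bool" where
  "smooth f \<longleftrightarrow> (\<forall>k. C_k k f)"

definition graph_map ::
    "(real^'m \<Rightarrow> real^'n) \<Rightarrow> real^'m \<Rightarrow> ('m::finite, 'n::finite) pseudo" where
  "graph_map u x = (x, u x)"

definition entire_graph :: "(real^'m \<Rightarrow> real^'n) \<Rightarrow> ('m::finite, 'n::finite) pseudo set" where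
  "entire_graph u = range (graph_map u)"

text \<open>Velocities at \<open>p\<close> of curves in \<open>M\<close>.\<close>

definition tangent_space ::
    "('m::finite, 'n::finite) pseudo set \<Rightarrow> ('m, 'n) pseudo \<Rightarrow> ('m, 'n) pseudo set" where
  "tangent_space M p =
     {v. \<exists>\<gamma>::real \<Rightarrow> ('m, 'n) pseudo.
           (\<forall>t. \<gamma> t \<in> M) \<and> \<gamma> 0 = p \<and> (\<gamma> has_vector_derivative v) (at 0)}"

definition spacelike :: "('m::finite, 'n::finite) pseudo set \<Rightarrow> bool" where
  "spacelike M \<longleftrightarrow> (\<forall>p\<in>M. positive_definite_on (tangent_space M p))"

definition induced_metric :: "(real^'m \<Rightarrow> real^'n) \<Rightarrow> real^'m \<Rightarrow> real^'m^('m::finite)" where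
  "induced_metric u x =
     (\<chi> i j. pinner (frechet_derivative (graph_map u) (at x) (axis i 1))
                    (frechet_derivative (graph_map u) (at x) (axis j 1) :: ('m, 'n::finite) pseudo))"

text \<open>
  The Riemannian volume of the induced metric, as a Borel measure on the ambient space
  concentrated on the graph: the image of \<open>sqrt (det g) dx\<close> under the global parametrisation.
\<close>

definition riemannian_volume ::
    "(real^'m \<Rightarrow> real^'n) \<Rightarrow> ('m::finite, 'n::finite) pseudo measure" where
  "riemannian_volume u =
     distr (density lborel (\<lambda>x. ennreal (sqrt (det (induced_metric u x))))) borel (graph_map u)"


section \<open>The \<open>w\<close>-function\<close>

definition frame_det ::
    "('m::finite \<Rightarrow> ('m, 'n::finite) pseudo) \<Rightarrow> ('m \<Rightarrow> ('m, 'n) pseudo) \<Rightarrow> real" where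
  "frame_det e a = det (\<chi> i j. pinner (e i) (a j))"

text \<open>
  The value does not depend on the chosen frame of the tangent space, see
  \<open>abs_frame_det_unique\<close> below.
\<close>

definition w_function ::
    "('m::finite, 'n::finite) pseudo set \<Rightarrow> ('m \<Rightarrow> ('m, 'n) pseudo) \<Rightarrow> ('m, 'n) pseudo \<Rightarrow> real" where
  "w_function M a p = \<bar>frame_det (SOME e. orthonormal_basis (tangent_space M p) e) a\<bar>"

lemma pinner_sum_left: "pinner (\<Sum>k\<in>K. c k *\<^sub>R f k) b = (\<Sum>k\<in>K. c k * pinner (f k) b)"
  by (induction K rule: infinite_finite_induct)
     (simp_all add: pinner_def algebra_simps sum.distrib sum_distrib_left)

lemma pinner_commute: "pinner a b = pinner b a"
  by (simp add: pinner_def mult.commute)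

lemma orthonormal_basis_expansion:
  assumes "orthonormal_basis V e" "v \<in> V"
  shows "v = (\<Sum>k\<in>UNIV. pinner v (e k) *\<^sub>R e k)"
proof -
  have on: "pinner (e i) (e j) = (if i = j then 1 else 0)" for i j
    using assms(1) by (simp add: orthonormal_basis_def)
  have "v \<in> span (range e)"
    using assms by (simp add: orthonormal_basis_def)
  then show ?thesis
  proof (induction rule: span_induct_alt)
    case base
    then show ?case by (simp add: pinner_def)
  next
    case (step c x y)
    then obtain i where x: "x = e i" by auto
    have "pinner (c *\<^sub>R x + y) (e k) = (if k = i then c else 0) + pinner y (e k)" for k
    proof -
      have "pinner (c *\<^sub>R x + y) (e k) = c * pinner (e i) (e k) + pinner y (e k)"
        by (simp add: x pinner_def algebra_simps sum.distrib sum_distrib_left)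
      then show ?thesis by (simp add: on)
    qed
    then have "(\<Sum>k\<in>UNIV. pinner (c *\<^sub>R x + y) (e k) *\<^sub>R e k)
        = (\<Sum>k\<in>UNIV. (if k = i then c *\<^sub>R e k else 0)) + (\<Sum>k\<in>UNIV. pinner y (e k) *\<^sub>R e k)"
      by (simp add: scaleR_add_left sum.distrib if_distrib[of "\<lambda>r. r *\<^sub>R _"] cong: if_cong)
    then show ?case using step.IH x by simp
  qed
qed

lemma abs_frame_det_unique:
  assumes e: "orthonormal_basis V e" and e': "orthonormal_basis V e'"
  shows "\<bar>frame_det e' a\<bar> = \<bar>frame_det e a\<bar>"
proof -
  define C where "C = (\<chi> i k. pinner (e' i) (e k))"
  have "e' i \<in> V" for i
    using e' span_base[of "e' i" "range e'"] by (auto simp: orthonormal_basis_def)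
  then have ex: "pinner (e' i) b = (\<Sum>k\<in>UNIV. pinner (e' i) (e k) * pinner (e k) b)" for i b
    using arg_cong[OF orthonormal_basis_expansion[OF e], of "e' i" "\<lambda>v. pinner v b"]
    by (simp add: pinner_sum_left)
  have "(\<chi> i j. pinner (e' i) (a j)) = C ** (\<chi> i j. pinner (e i) (a j))"
    by (simp add: vec_eq_iff matrix_matrix_mult_def C_def ex[of _ "a _"])
  then have 1: "frame_det e' a = det C * frame_det e a"
    by (simp add: frame_det_def det_mul)
  have "C ** transpose C = (\<chi> i j. pinner (e' i) (e' j))"
    by (simp add: vec_eq_iff matrix_matrix_mult_def transpose_def C_def ex[of _ "e' _"]
          pinner_commute[of "e _" "e' _"])
  also have "\<dots> = mat 1"
    using e' by (simp add: orthonormal_basis_def mat_def)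
  finally have "det C * det C = 1"
    by (metis det_I det_mul det_transpose)
  then have "\<bar>det C\<bar> = 1"
    by (metis abs_square_eq_1 power2_eq_square)
  then show ?thesis by (simp add: 1 abs_mult)
qed

end

theory Submission
  imports Defs "HOL-Real_Asymp.Real_Asymp"
begin

text \<open>
  In the graph coordinates \<open>x\<close>, the integrand \<open>w\<close> times the volume density is the absolute Jacobian
  of the projection of the graph to \<open>P\<close>. It is bounded by a constant because spacelikeness forces
  \<open>norm (Du v) < norm v\<close>. Hence it suffices to control the Lebesgue measure of the sublevel sets of
  \<open>z\<close>. The map \<open>u\<close> strictly decreases distances and \<open>u 0 = 0\<close>, so \<open>norm u \<le> 1 - \<delta>\<close> on the
  compact unit sphere for some \<open>\<delta> > 0\<close>, and therefore \<open>norm (u x) \<le> norm x - \<delta>\<close> outside the unit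
  ball. Thus \<open>z\<close> grows at least linearly, \<open>{z \<le> R\<^sup>2}\<close> lies over a ball of radius \<open>O(R\<^sup>2)\<close>, and
  \<open>exp (- \<alpha> z)\<close> decays exponentially in \<open>norm x\<close>.
\<close>

section \<open>Gram-Schmidt for the indefinite inner product, and a determinant bound\<close>

lemma pinner_eq_inner: "pinner a b = fst a \<bullet> fst b - snd a \<bullet> snd b"
  by (simp add: pinner_def inner_vec_def)

lemma pinner_self: "pinner p p = (norm (fst p))\<^sup>2 - (norm (snd p))\<^sup>2"
  by (simp add: pinner_eq_inner power2_norm_eq_inner)

lemma pinner_scaleR_left: "pinner (c *\<^sub>R a) b = c * pinner a b"
  by (simp add: pinner_eq_inner algebra_simps)

lemma pinner_scaleR_right: "pinner a (c *\<^sub>R b) = c * pinner a b"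
  by (simp add: pinner_eq_inner algebra_simps)

lemma pinner_diff_left: "pinner (a - b) c = pinner a c - pinner b c"
  by (simp add: pinner_eq_inner algebra_simps)

text \<open>Positive definiteness on \<open>V\<close> lets the Euclidean induction go through: the
  remainder of \<open>X i\<close> is a nonzero vector of \<open>V\<close>, so its square is positive
  and it can be normalised. This supplies orthonormal bases of tangent spaces.\<close>

lemma pinner_gram_schmidt:
  fixes X :: "'i \<Rightarrow> ('m::finite, 'n::finite) pseudo"
  assumes "finite I" and V: "subspace V" "positive_definite_on V"
    and "X ` I \<subseteq> V" and "inj_on X I" and "independent (X ` I)"
  shows "\<exists>e. span (e ` I) = span (X ` I) \<and>
    (\<forall>i\<in>I. \<forall>j\<in>I. pinner (e i) (e j) = (if i = j then 1 else 0))"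
  using assms(1,4-)
proof (induction I)
  case empty
  then show ?case by simp
next
  case (insert i I)
  have ind: "independent (X ` I)"
    by (rule independent_mono[OF insert.prems(3)]) auto
  obtain e where sp: "span (e ` I) = span (X ` I)"
    and on: "\<And>k j. k \<in> I \<Longrightarrow> j \<in> I \<Longrightarrow> pinner (e k) (e j) = (if k = j then 1 else 0)"
    using insert.IH insert.prems ind by auto
  have "X i \<notin> X ` I"
    using insert.prems(2) insert.hyps(2) by auto
  then have notin: "X i \<notin> span (X ` I)"
    using insert.prems(3) by (simp add: independent_insert)
  \<comment> \<open>\<open>s\<close> is the projection, orthogonal for \<open>pinner\<close>, of
    \<open>X i\<close> onto the span of the vectors built so far; \<open>y\<close> is the
    remainder.\<close>
  define s where "s = (\<Sum>k\<in>I. pinner (X i) (e k) *\<^sub>R e k)"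
  define y where "y = X i - s"
  have s: "s \<in> span (e ` I)"
    unfolding s_def by (intro span_sum span_scale span_base) auto
  have "span (X ` I) \<subseteq> V"
    using insert.prems(1) V(1) by (intro span_minimal) auto
  then have "y \<in> V"
    using s sp insert.prems(1) V(1) by (auto simp: y_def intro!: subspace_diff)
  \<comment> \<open>Otherwise \<open>X i\<close> would equal \<open>s\<close> and lie in the span of
    the earlier vectors, against independence.\<close>
  moreover have "y \<noteq> 0"
    using notin s sp by (auto simp: y_def)
  ultimately have pos: "pinner y y > 0"
    using V(2) by (auto simp: positive_definite_on_def)
  have orth: "pinner y (e j) = 0" if "j \<in> I" for j
  proof -
    have "pinner s (e j) = (\<Sum>k\<in>I. pinner (X i) (e k) * (if k = j then 1 else 0))"
      unfolding s_def pinner_sum_left using on that by (intro sum.cong) auto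
    also have "\<dots> = pinner (X i) (e j)"
      using that insert.hyps(1) by (simp add: if_distrib sum.delta cong: if_cong)
    finally show ?thesis by (simp add: y_def pinner_diff_left)
  qed
  define c where "c = inverse (sqrt (pinner y y))"
  have c: "c \<noteq> 0" "c * c * pinner y y = 1"
    using pos by (simp_all add: c_def field_simps)
  define f where "f = e(i := c *\<^sub>R y)"
  have fe: "f j = e j" if "j \<in> I" for j
    using that insert.hyps(2) by (auto simp: f_def)
  have "f ` insert i I = insert (c *\<^sub>R y) (e ` I)"
    using fe by (simp add: image_insert cong: image_cong) (simp add: f_def)
  \<comment> \<open>Modulo the old span, \<open>c *\<^sub>R y\<close> is a nonzero multiple of
    \<open>X i\<close>, so each vector can be exchanged for the other.\<close>
  also have "span \<dots> = span (insert (X i) (e ` I))"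
  proof (rule span_eq[THEN iffD2], intro conjI)
    have "s \<in> span (insert (X i) (e ` I))"
      using s span_mono[of "e ` I" "insert (X i) (e ` I)"] by blast
    then have "c *\<^sub>R y \<in> span (insert (X i) (e ` I))"
      unfolding y_def by (intro span_scale span_diff) (auto intro: span_base)
    then show "insert (c *\<^sub>R y) (e ` I) \<subseteq> span (insert (X i) (e ` I))"
      by (auto intro: span_base)
    have "s \<in> span (insert (c *\<^sub>R y) (e ` I))"
      using s span_mono[of "e ` I" "insert (c *\<^sub>R y) (e ` I)"] by blast
    moreover have "inverse c *\<^sub>R c *\<^sub>R y \<in> span (insert (c *\<^sub>R y) (e ` I))"
      by (rule span_scale, rule span_base) simp
    ultimately have "inverse c *\<^sub>R c *\<^sub>R y + s \<in> span (insert (c *\<^sub>R y) (e ` I))"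
      by (intro span_add)
    then have "X i \<in> span (insert (c *\<^sub>R y) (e ` I))"
      using c(1) by (simp add: y_def)
    then show "insert (X i) (e ` I) \<subseteq> span (insert (c *\<^sub>R y) (e ` I))"
      by (auto intro: span_base)
  qed
  also have "\<dots> = span (X ` insert i I)"
    by (simp add: span_insert sp)
  finally have "span (f ` insert i I) = span (X ` insert i I)" .
  moreover have "pinner (f k) (f j) = (if k = j then 1 else 0)"
    if "k \<in> insert i I" "j \<in> insert i I" for k j
  proof -
    have fi: "f i = c *\<^sub>R y" by (simp add: f_def)
    have "pinner (f i) (f i) = 1"
      using c(2) by (simp add: fi pinner_scaleR_left pinner_scaleR_right)
    moreover have "pinner (f i) (f j) = 0" "pinner (f j) (f i) = 0" if "j \<in> I" for j
      using orth[OF that] that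
      by (simp_all add: fi fe pinner_scaleR_left pinner_scaleR_right pinner_commute[of "e j"])
    ultimately show ?thesis
      using that on fe insert.hyps(2) by auto
  qed
  ultimately show ?case by blast
qed

text \<open>The Leibniz formula has \<open>fact CARD('n)\<close> terms, each up to sign a product of
  \<open>CARD('n)\<close> entries.\<close>

lemma abs_det_le:
  fixes A :: "real^'n^'n"
  assumes "\<And>i j. \<bar>A $ i $ j\<bar> \<le> K"
  shows "\<bar>det A\<bar> \<le> fact CARD('n) * K ^ CARD('n)"
proof -
  have "\<bar>det A\<bar> \<le> (\<Sum>p | p permutes (UNIV :: 'n set). \<bar>of_int (sign p) * (\<Prod>i\<in>UNIV. A $ i $ p i)\<bar>)"
    unfolding det_def by (rule sum_abs)
  also have "\<dots> \<le> (\<Sum>p | p permutes (UNIV :: 'n set). K ^ CARD('n))"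
  proof (rule sum_mono)
    fix p :: "'n \<Rightarrow> 'n"
    have "\<bar>of_int (sign p) * (\<Prod>i\<in>UNIV. A $ i $ p i)\<bar> = (\<Prod>i\<in>UNIV. \<bar>A $ i $ p i\<bar>)"
      by (simp add: abs_mult abs_prod sign_def)
    also have "\<dots> \<le> (\<Prod>i\<in>(UNIV :: 'n set). K)"
      using assms by (intro prod_mono) auto
    finally show "\<bar>of_int (sign p) * (\<Prod>i\<in>UNIV. A $ i $ p i)\<bar> \<le> K ^ CARD('n)" by simp
  qed
  also have "\<dots> = fact CARD('n) * K ^ CARD('n)"
    by (simp add: card_permutations[OF refl])
  finally show ?thesis .
qed

section \<open>Derivative of the parametrisation and tangent space of the graph\<close>

lemma smooth_differentiable: "smooth u \<Longrightarrow> u differentiable (at x)"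
  unfolding smooth_def by (metis C_k.simps(2))

lemma smooth_continuous_frechet_derivative:
  "smooth u \<Longrightarrow> continuous_on UNIV (\<lambda>x. frechet_derivative u (at x) v)"
  unfolding smooth_def by (metis C_k.simps)

lemma smooth_continuous: "smooth u \<Longrightarrow> continuous_on UNIV u"
  unfolding smooth_def by (metis C_k.simps(1))

lemma graph_map_has_derivative:
  assumes "u differentiable (at x)"
  shows "(graph_map u has_derivative (\<lambda>v. (v, frechet_derivative u (at x) v))) (at x)"
  unfolding graph_map_def
  using assms by (intro has_derivative_Pair has_derivative_ident) (simp add: frechet_derivative_works)

lemma frechet_derivative_graph_map:
  assumes "u differentiable (at x)"
  shows "frechet_derivative (graph_map u) (at x) = (\<lambda>v. (v, frechet_derivative u (at x) v))"
  using frechet_derivative_at[OF graph_map_has_derivative[OF assms]] by simp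

text \<open>A curve in the graph is the lift of its first component, so the chain rule determines
  its velocity. Conversely, lifting the straight line through \<open>x\<close> in direction
  \<open>y\<close> realises the tangent vector over \<open>y\<close>.\<close>

lemma tangent_space_entire_graph:
  assumes "u differentiable (at x)"
  shows "tangent_space (entire_graph u) (graph_map u x) =
    range (\<lambda>v. (v, frechet_derivative u (at x) v))"
proof (intro equalityI subsetI)
  fix v assume "v \<in> tangent_space (entire_graph u) (graph_map u x)"
  then obtain \<gamma> :: "real \<Rightarrow> _" where \<gamma>: "\<And>t. \<gamma> t \<in> entire_graph u" "\<gamma> 0 = graph_map u x"
    "(\<gamma> has_vector_derivative v) (at 0)"
    by (auto simp: tangent_space_def)
  have eq: "\<gamma> = graph_map u \<circ> (\<lambda>t. fst (\<gamma> t))"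
  proof
    fix t
    obtain y where "\<gamma> t = graph_map u y"
      using \<gamma>(1)[of t] by (auto simp: entire_graph_def)
    then show "\<gamma> t = (graph_map u \<circ> (\<lambda>t. fst (\<gamma> t))) t"
      by (simp add: graph_map_def)
  qed
  have d: "((\<lambda>t. fst (\<gamma> t)) has_derivative (\<lambda>t. t *\<^sub>R fst v)) (at 0)"
    using has_derivative_fst[OF \<gamma>(3)[unfolded has_vector_derivative_def]] by simp
  have x: "fst (\<gamma> 0) = x"
    using \<gamma>(2) by (simp add: graph_map_def)
  have "(\<gamma> has_derivative ((\<lambda>v. (v, frechet_derivative u (at x) v)) \<circ> (\<lambda>t. t *\<^sub>R fst v))) (at 0)"
    by (subst eq, rule diff_chain_at[OF d]) (simp add: x graph_map_has_derivative[OF assms])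
  \<comment> \<open>Two derivatives of the same curve at 0 must agree; evaluating at 1 recovers
    \<open>v\<close> itself.\<close>
  then have "(\<lambda>t. t *\<^sub>R v) = (\<lambda>v. (v, frechet_derivative u (at x) v)) \<circ> (\<lambda>t. t *\<^sub>R fst v)"
    using \<gamma>(3) has_derivative_unique unfolding has_vector_derivative_def by blast
  from fun_cong[OF this, of 1] show "v \<in> range (\<lambda>v. (v, frechet_derivative u (at x) v))"
    by auto
next
  fix v assume "v \<in> range (\<lambda>v. (v, frechet_derivative u (at x) v))"
  then obtain y where v: "v = (y, frechet_derivative u (at x) y)" by auto
  have "((\<lambda>t::real. x + t *\<^sub>R y) has_derivative (\<lambda>t. t *\<^sub>R y)) (at 0)"
    by (auto intro!: derivative_eq_intros)
  then have "(graph_map u \<circ> (\<lambda>t::real. x + t *\<^sub>R y) has_derivative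
      (\<lambda>v. (v, frechet_derivative u (at x) v)) \<circ> (\<lambda>t. t *\<^sub>R y)) (at 0)"
    by (rule diff_chain_at) (simp add: graph_map_has_derivative[OF assms])
  moreover have "linear (frechet_derivative u (at x))"
    using assms by (rule linear_frechet_derivative)
  ultimately have "(graph_map u \<circ> (\<lambda>t::real. x + t *\<^sub>R y) has_vector_derivative v) (at 0)"
    by (simp add: has_vector_derivative_def v o_def linear_cmul)
  then show "v \<in> tangent_space (entire_graph u) (graph_map u x)"
    unfolding tangent_space_def
    by (auto simp: entire_graph_def intro!: exI[of _ "graph_map u \<circ> (\<lambda>t::real. x + t *\<^sub>R y)"])
qed

section \<open>Contraction property of \<open>u\<close> and growth of the squared length\<close>

text \<open>The square of the tangent vector over \<open>v\<close> is the squared norm of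
  \<open>v\<close> minus that of its image under the derivative of \<open>u\<close>, and
  spacelikeness makes it positive.\<close>

lemma norm_frechet_derivative_less:
  assumes "spacelike (entire_graph u)" "u differentiable (at x)" "v \<noteq> 0"
  shows "norm (frechet_derivative u (at x) v) < norm v"
proof -
  have "positive_definite_on (tangent_space (entire_graph u) (graph_map u x))"
    using assms(1) by (auto simp: spacelike_def entire_graph_def)
  then have "pinner (v, frechet_derivative u (at x) v) (v, frechet_derivative u (at x) v) > 0"
    unfolding tangent_space_entire_graph[OF assms(2)] positive_definite_on_def
    using assms(3) by (auto simp: zero_prod_def)
  then show ?thesis
    by (simp add: pinner_self power2_less_imp_less)
qed

text \<open>The mean value theorem on the segment from \<open>x\<close> to \<open>y\<close> bounds
  the increment by the derivative at a single intermediate point. This keeps the inequality strict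
  without a uniform bound below 1 on the derivative.\<close>

lemma spacelike_graph_distance_less:
  assumes "spacelike (entire_graph u)" and diff: "\<And>x. u differentiable (at x)" and "x \<noteq> y"
  shows "norm (u y - u x) < norm (y - x)"
proof -
  define f where "f = (\<lambda>t::real. u (x + t *\<^sub>R (y - x)))"
  have d: "(f has_derivative (\<lambda>h. frechet_derivative u (at (x + t *\<^sub>R (y - x))) (h *\<^sub>R (y - x)))) (at t)"
    for t
  proof -
    have "((\<lambda>t::real. x + t *\<^sub>R (y - x)) has_derivative (\<lambda>h. h *\<^sub>R (y - x))) (at t)"
      by (auto intro!: derivative_eq_intros)
    from diff_chain_at[OF this diff[unfolded frechet_derivative_works]]
    show ?thesis by (simp add: f_def o_def)
  qed
  have "continuous_on {0..1} f"
    using d has_derivative_continuous by (blast intro: continuous_at_imp_continuous_on)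
  from mvt_general[OF _ this d] obtain t where
    "norm (f 1 - f 0) \<le> norm (frechet_derivative u (at (x + t *\<^sub>R (y - x))) ((1 - 0) *\<^sub>R (y - x)))"
    by auto
  also have "\<dots> < norm (y - x)"
    using norm_frechet_derivative_less[OF assms(1) diff] \<open>x \<noteq> y\<close> by simp
  finally show ?thesis by (simp add: f_def)
qed

text \<open>Compactness of the unit sphere turns the strict contraction into a gap \<delta>. Outward
  along a ray the norm of \<open>u\<close> grows no faster than \<open>norm x\<close>, so the gap
  persists, and squaring makes it linear in \<open>norm x\<close>.\<close>

lemma spacelike_graph_pinner_growth:
  fixes u :: "real^'m::finite \<Rightarrow> real^'n::finite"
  assumes sp: "spacelike (entire_graph u)" and diff: "\<And>x. u differentiable (at x)" and u0: "u 0 = 0"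
  obtains \<delta> where "\<delta> > 0"
    "\<And>x. pinner (graph_map u x) (graph_map u x) \<ge> 2 * \<delta> * (norm x - 1)"
proof -
  have cont: "continuous_on (sphere 0 1) (\<lambda>x. norm (u x))"
    using diff by (intro continuous_on_norm continuous_at_imp_continuous_on)
      (auto intro: differentiable_imp_continuous_within)
  \<comment> \<open>The maximum over the sphere needs a point on it; index types are nonempty, so
    any coordinate axis serves.\<close>
  have "axis undefined 1 \<in> sphere (0 :: real^'m) 1" by simp
  then obtain x0 where x0: "norm x0 = 1" "\<And>x. norm x = 1 \<Longrightarrow> norm (u x) \<le> norm (u x0)"
    using continuous_attains_sup[OF compact_sphere _ cont] by force
  define \<delta> where "\<delta> = 1 - norm (u x0)"
  have less: "norm (u y - u x) < norm (y - x)" if "x \<noteq> y" for x y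
    using spacelike_graph_distance_less[OF sp diff that] .
  have le: "norm (u y - u x) \<le> norm (y - x)" for x y
    using less[of x y] by (cases "x = y") auto
  \<comment> \<open>Positivity is strict contraction between 0 and \<open>x0\<close>, using
    \<open>u 0 = 0\<close>. The upper bound 1 later absorbs the quadratic term
    \<open>\<delta> * \<delta>\<close> into \<open>2 * \<delta>\<close>.\<close>
  have \<delta>: "0 < \<delta>" "\<delta> \<le> 1"
    using less[of 0 x0] x0(1) u0 by (cases "x0 = 0"; simp add: \<delta>_def)+
  have "pinner (graph_map u x) (graph_map u x) \<ge> 2 * \<delta> * (norm x - 1)" for x
  proof (cases "norm x \<le> 1")
    case True
    \<comment> \<open>Inside the unit ball the claimed lower bound is nonpositive, while contraction
      from the origin makes the square nonnegative.\<close>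
    then have "2 * \<delta> * (norm x - 1) \<le> 0"
      using \<delta> by (simp add: mult_nonneg_nonpos)
    also have "\<dots> \<le> (norm x)\<^sup>2 - (norm (u x))\<^sup>2"
      using le[of x 0] u0 by (simp add: power_mono)
    finally show ?thesis by (simp add: pinner_self graph_map_def)
  next
    case False
    \<comment> \<open>The radial projection of \<open>x\<close> to the unit sphere: on a common ray
      the distance is exactly \<open>norm x - 1\<close>, so nothing is lost in the triangle
      inequality for the domain.\<close>
    define y where "y = x /\<^sub>R norm x"
    have "norm x > 0" using False by linarith
    then have "x = norm x *\<^sub>R y" and ny: "norm y = 1"
      by (simp_all add: y_def)
    then have "x - y = (norm x - 1) *\<^sub>R y"
      by (metis scaleR_left_diff_distrib scaleR_one)
    then have "norm (x - y) = norm x - 1"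
      using False ny by simp
    moreover have "norm (u x) \<le> norm (u y) + norm (u x - u y)"
      by (metis add.commute diff_add_cancel norm_triangle_ineq)
    ultimately have "norm (u x) \<le> norm x - \<delta>"
      using x0(2)[OF ny] le[of x y] by (simp add: \<delta>_def)
    then have "(norm (u x))\<^sup>2 \<le> (norm x - \<delta>)\<^sup>2"
      by (simp add: power_mono)
    also have "\<dots> = (norm x)\<^sup>2 - 2 * \<delta> * norm x + \<delta> * \<delta>"
      by (simp add: power2_eq_square algebra_simps)
    also have "\<dots> \<le> (norm x)\<^sup>2 - 2 * \<delta> * norm x + 2 * \<delta>"
      using \<delta> by (simp add: mult_left_le)
    finally show ?thesis
      by (simp add: pinner_self graph_map_def algebra_simps)
  qed
  with \<delta>(1) show ?thesis by (rule that)
qed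

section \<open>The \<open>w\<close>-function times the volume density as a bounded Jacobian\<close>

text \<open>The \<open>w\<close>-function picks its frame by \<open>SOME\<close>, so existence is
  required before the frame can be used. The injective derivative of the graph map carries the
  coordinate axes to a basis, which is then orthonormalised.\<close>

lemma ex_orthonormal_basis_tangent_space:
  fixes u :: "real^'m::finite \<Rightarrow> real^'n::finite"
  assumes sp: "spacelike (entire_graph u)" and diff: "u differentiable (at x)"
  shows "\<exists>e. orthonormal_basis (tangent_space (entire_graph u) (graph_map u x)) e"
proof -
  define L where "L = (\<lambda>v. (v, frechet_derivative u (at x) v))"
  define V where "V = tangent_space (entire_graph u) (graph_map u x)"
  have V: "V = range L"
    by (simp add: V_def L_def tangent_space_entire_graph[OF diff])
  have lin: "linear L"
    unfolding L_def using graph_map_has_derivative[OF diff] by (rule has_derivative_linear)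
  have inj: "inj L" by (auto simp: L_def inj_on_def)
  have "Basis = range (\<lambda>i. axis i (1::real) :: real^'m)"
    by (auto simp: Basis_vec_def)
  then have B: "range (\<lambda>i. L (axis i 1)) = L ` Basis"
    by (metis image_image)
  have "independent (L ` Basis)"
    using inj by (intro linear_independent_injective_image[OF lin] independent_Basis)
      (auto intro: inj_on_subset)
  moreover have spV: "span (L ` Basis) = V"
    by (simp add: linear_span_image[OF lin] V)
  moreover have "inj (\<lambda>i. L (axis i 1))"
    by (simp add: inj_def inj_eq[OF inj] axis_eq_axis)
  moreover have "positive_definite_on V"
    using sp by (auto simp: V_def spacelike_def entire_graph_def)
  moreover have "subspace V"
    unfolding spV[symmetric] by (rule subspace_span)
  moreover have "L ` Basis \<subseteq> V"
    by (auto simp: V)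
  ultimately obtain e :: "'m \<Rightarrow> ('m, 'n) pseudo" where "span (range e) = V" "\<And>i j. pinner (e i) (e j) = (if i = j then 1 else 0)"
    using pinner_gram_schmidt[of UNIV V "\<lambda>i. L (axis i 1)"] unfolding B
    by auto
  then show ?thesis
    by (auto simp: orthonormal_basis_def V_def)
qed

text \<open>Let \<open>B\<close> hold the coordinates of the coordinate tangent vectors in the
  chosen frame. The metric is \<open>B ** transpose B\<close>, so the density is the absolute value
  of \<open>det B\<close>, and multiplicativity of determinants removes the frame.\<close>

lemma w_function_mult_volume_density:
  fixes u :: "real^'m::finite \<Rightarrow> real^'n::finite"
  assumes sp: "spacelike (entire_graph u)" and diff: "u differentiable (at x)"
  shows "w_function (entire_graph u) a (graph_map u x) * sqrt (det (induced_metric u x)) =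
    \<bar>det (\<chi> k j. pinner (frechet_derivative (graph_map u) (at x) (axis k 1)) (a j))\<bar>"
proof -
  define X where "X k = frechet_derivative (graph_map u) (at x) (axis k 1)" for k
  define V where "V = tangent_space (entire_graph u) (graph_map u x)"
  define e where "e = (SOME e. orthonormal_basis V e)"
  have e: "orthonormal_basis V e"
    unfolding e_def V_def
    using ex_orthonormal_basis_tangent_space[OF sp diff] by (rule someI_ex)
  have X: "X k \<in> V" for k
    by (simp add: X_def V_def tangent_space_entire_graph[OF diff] frechet_derivative_graph_map[OF diff])
  define B where "B = (\<chi> k l. pinner (X k) (e l))"
  have ex: "pinner (X k) b = (\<Sum>l\<in>UNIV. pinner (X k) (e l) * pinner (e l) b)" for k b
    using arg_cong[OF orthonormal_basis_expansion[OF e X], of "\<lambda>v. pinner v b"]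
    by (simp add: pinner_sum_left)
  have "induced_metric u x = B ** transpose B"
    by (simp add: vec_eq_iff induced_metric_def matrix_matrix_mult_def transpose_def B_def
        X_def[symmetric] ex[of _ "X _"] pinner_commute[of "e _" "X _"])
  then have "sqrt (det (induced_metric u x)) = \<bar>det B\<bar>"
    by (simp add: det_mul)
  moreover have "(\<chi> k j. pinner (X k) (a j)) = B ** (\<chi> l j. pinner (e l) (a j))"
    by (simp add: vec_eq_iff matrix_matrix_mult_def B_def ex[of _ "a _"])
  ultimately show ?thesis
    by (simp add: w_function_def frame_det_def det_mul abs_mult e_def V_def X_def)
qed

lemma w_function_mult_volume_density_bounded:
  fixes u :: "real^'m::finite \<Rightarrow> real^'n::finite"
  assumes sp: "spacelike (entire_graph u)" and diff: "\<And>x. u differentiable (at x)"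
  obtains C where "C > 0"
    "\<And>x. w_function (entire_graph u) a (graph_map u x) * sqrt (det (induced_metric u x)) \<le> C"
proof -
  \<comment> \<open>By Cauchy-Schwarz on both factors each matrix entry is at most
    \<open>2 * norm (a j)\<close>; the sum bounds all columns at once.\<close>
  define K where "K = (\<Sum>j\<in>UNIV. 2 * norm (a j))"
  have "\<bar>pinner (frechet_derivative (graph_map u) (at x) (axis k 1)) (a j)\<bar> \<le> K" for x k j
  proof -
    define D where "D = frechet_derivative u (at x) (axis k 1)"
    have D: "norm D \<le> 1"
      using norm_frechet_derivative_less[OF sp diff, of "axis k 1" x] by (simp add: D_def axis_eq_0_iff)
    have "\<bar>pinner (axis k 1, D) (a j)\<bar> \<le> \<bar>axis k 1 \<bullet> fst (a j)\<bar> + \<bar>D \<bullet> snd (a j)\<bar>"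
      by (simp add: pinner_eq_inner)
    also have "\<dots> \<le> norm (axis k (1::real)) * norm (fst (a j)) + norm D * norm (snd (a j))"
      by (intro add_mono Cauchy_Schwarz_ineq2)
    also have "\<dots> \<le> 1 * norm (a j) + 1 * norm (a j)"
      using D norm_fst_le[of "fst (a j)" "snd (a j)"] norm_snd_le[of "snd (a j)" "fst (a j)"]
      by (intro add_mono mult_mono) auto
    also have "\<dots> \<le> K"
      using member_le_sum[of j UNIV "\<lambda>j. 2 * norm (a j)"] by (simp add: K_def)
    finally show ?thesis
      by (simp add: frechet_derivative_graph_map[OF diff] D_def)
  qed
  then have "w_function (entire_graph u) a (graph_map u x) * sqrt (det (induced_metric u x))
      \<le> fact CARD('m) * K ^ CARD('m)" for x
    unfolding w_function_mult_volume_density[OF sp diff] by (intro abs_det_le) simp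
  moreover have "K \<ge> 0" by (simp add: K_def sum_nonneg)
  \<comment> \<open>The added 1 makes the constant strictly positive even if \<open>K\<close> is
    0.\<close>
  ultimately show ?thesis
    by (intro that[of "fact CARD('m) * K ^ CARD('m) + 1"])
      (auto intro: add_nonneg_pos add_increasing2)
qed

section \<open>Measurability and transfer of integrals to the parameter domain\<close>

lemma measurable_graph_map:
  assumes "smooth u"
  shows "graph_map u \<in> borel_measurable borel"
  unfolding graph_map_def
  using smooth_continuous[OF assms] by (intro borel_measurable_continuous_onI continuous_intros)

lemma measurable_volume_density:
  assumes "smooth u"
  shows "(\<lambda>x. sqrt (det (induced_metric u x))) \<in> borel_measurable borel"
proof -
  have "continuous_on UNIV (\<lambda>x. induced_metric u x $ i $ j)" for i j
    unfolding induced_metric_def frechet_derivative_graph_map[OF smooth_differentiable[OF assms]]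
      pinner_eq_inner
    using smooth_continuous_frechet_derivative[OF assms] by (auto intro!: continuous_intros)
  then have "continuous_on UNIV (\<lambda>x. sqrt (det (induced_metric u x)))"
    unfolding det_def by (intro continuous_on_real_sqrt continuous_on_sum continuous_on_mult
      continuous_on_prod continuous_on_const)
  then show ?thesis by (rule borel_measurable_continuous_onI)
qed

text \<open>
  The \<open>w\<close>-function is not known to be measurable off the graph, so it is first replaced by the
  Borel majorant \<open>C / sqrt (det g)\<close>. If \<open>det g = 0\<close>, the quotient is \<open>\<infinity>\<close> and its product with
  \<open>sqrt (det g)\<close> is \<open>0\<close>.
\<close>

lemma nn_integral_w_function_le:
  fixes u :: "real^'m::finite \<Rightarrow> real^'n::finite" and a :: "'m \<Rightarrow> ('m, 'n) pseudo"
  assumes "smooth u" and sp: "spacelike (entire_graph u)"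
  obtains C where "C \<ge> 0"
    "\<And>F. F \<in> borel_measurable borel \<Longrightarrow>
      (\<integral>\<^sup>+p\<in>entire_graph u. ennreal (w_function (entire_graph u) a p) * F p \<partial>riemannian_volume u)
        \<le> ennreal C * (\<integral>\<^sup>+x. F (graph_map u x) \<partial>lborel)"
proof -
  note diff = smooth_differentiable[OF \<open>smooth u\<close>]
  obtain C where C: "C > 0"
    "\<And>x. w_function (entire_graph u) a (graph_map u x) * sqrt (det (induced_metric u x)) \<le> C"
    using w_function_mult_volume_density_bounded[OF sp diff] by blast
  define s where "s x = ennreal (sqrt (det (induced_metric u x)))" for x
  have [measurable]: "s \<in> borel_measurable borel" "graph_map u \<in> borel_measurable borel"
    unfolding s_def using measurable_volume_density measurable_graph_map \<open>smooth u\<close> by measurable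
  \<comment> \<open>\<open>fst\<close> recovers the parameter from a point of the graph, so the
    majorant becomes a Borel function of the ambient point.\<close>
  have [measurable]: "(fst :: ('m, 'n) pseudo \<Rightarrow> real^'m) \<in> borel_measurable borel"
    by (intro borel_measurable_continuous_onI continuous_intros)
  have w: "ennreal (w_function (entire_graph u) a (graph_map u x)) \<le> ennreal C / s x" for x
  proof (cases "sqrt (det (induced_metric u x)) > 0")
    case True
    then show ?thesis
      using C(2)[of x] by (simp add: s_def divide_ennreal C(1)[THEN less_imp_le] pos_le_divide_eq ennreal_leI)
  next
    case False
    then have "s x = 0" by (simp add: s_def ennreal_neg)
    then show ?thesis using C(1) by (simp add: ennreal_divide_zero)
  qed
  show ?thesis
  proof (rule that[OF C(1)[THEN less_imp_le]])
    fix F :: "('m, 'n) pseudo \<Rightarrow> ennreal" assume [measurable]: "F \<in> borel_measurable borel"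
    have "(\<integral>\<^sup>+p\<in>entire_graph u. ennreal (w_function (entire_graph u) a p) * F p \<partial>riemannian_volume u)
        \<le> (\<integral>\<^sup>+p. ennreal C / s (fst p) * F p \<partial>riemannian_volume u)"
    proof (rule nn_integral_mono)
      fix p
      show "ennreal (w_function (entire_graph u) a p) * F p * indicator (entire_graph u) p
          \<le> ennreal C / s (fst p) * F p"
      proof (cases "p \<in> entire_graph u")
        case True
        then obtain x where "p = graph_map u x" by (auto simp: entire_graph_def)
        with w[of x] True show ?thesis by (simp add: mult_right_mono graph_map_def)
      qed simp
    qed
    also have "\<dots> = (\<integral>\<^sup>+x. ennreal C / s x * F (graph_map u x) \<partial>density lborel s)"
      unfolding riemannian_volume_def s_def[symmetric]
      by (subst nn_integral_distr) (auto simp: graph_map_def)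
    also have "\<dots> = (\<integral>\<^sup>+x. s x * (ennreal C / s x * F (graph_map u x)) \<partial>lborel)"
      by (subst nn_integral_density) auto
    also have "\<dots> \<le> (\<integral>\<^sup>+x. ennreal C * F (graph_map u x) \<partial>lborel)"
    proof (rule nn_integral_mono)
      fix x
      \<comment> \<open>For nonzero \<open>s x\<close> the factors cancel, because
        \<open>s x\<close> comes from a real number and is finite.\<close>
      have "s x * (ennreal C / s x) \<le> ennreal C"
        by (cases "s x = 0") (simp_all add: ennreal_times_divide mult_divide_eq_ennreal
            mult.commute[of "s x"], simp add: s_def mult_divide_eq_ennreal)
      then show "s x * (ennreal C / s x * F (graph_map u x)) \<le> ennreal C * F (graph_map u x)"
        by (simp add: mult.assoc[symmetric] mult_right_mono)
    qed
    also have "\<dots> = ennreal C * (\<integral>\<^sup>+x. F (graph_map u x) \<partial>lborel)"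
      by (intro nn_integral_cmult) auto
    finally show "(\<integral>\<^sup>+p\<in>entire_graph u. ennreal (w_function (entire_graph u) a p) * F p
        \<partial>riemannian_volume u) \<le> ennreal C * (\<integral>\<^sup>+x. F (graph_map u x) \<partial>lborel)" .
  qed
qed

section \<open>Exponential integrability and the two final estimates\<close>

text \<open>On the shell where \<open>norm x\<close> has integer part \<open>k\<close> the integrand
  is at most \<open>exp (- c * k)\<close>, and the shell lies in the ball of radius
  \<open>k + 1\<close>. The resulting series has terms of polynomial times exponential type.\<close>

lemma nn_integral_exp_norm_finite:
  fixes c :: real
  assumes "c > 0"
  shows "(\<integral>\<^sup>+x. ennreal (exp (- c * norm (x :: 'a::euclidean_space))) \<partial>lborel) < \<infinity>"
proof -
  define d where "d = DIM('a)"
  define b where "b k = exp (- c * real k) * (unit_ball_vol d * (real k + 1) ^ d)" for k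
  \<comment> \<open>Half of the exponential rate absorbs the polynomial volume factor, leaving a
    convergent geometric series.\<close>
  have "b \<in> O(\<lambda>k. exp (- c / 2) ^ k)"
    unfolding b_def exp_of_nat_mult[symmetric] using assms by real_asymp
  moreover have "summable (\<lambda>k. norm (exp (- c / 2) ^ k))"
    using assms by (simp add: norm_power summable_geometric)
  ultimately have b: "summable b"
    by (rule summable_comparison_test_bigo[rotated])
  have "(\<integral>\<^sup>+x. ennreal (exp (- c * norm (x :: 'a))) \<partial>lborel)
      \<le> (\<integral>\<^sup>+x. (\<Sum>k. ennreal (exp (- c * real k)) * indicator (cball (0 :: 'a) (real k + 1)) x) \<partial>lborel)"
  proof (rule nn_integral_mono)
    fix x :: 'a
    define k where "k = nat \<lfloor>norm x\<rfloor>"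
    have k: "real k \<le> norm x" "norm x \<le> real k + 1"
      unfolding k_def by (simp_all add: less_imp_le)
    have "ennreal (exp (- c * norm x)) \<le> ennreal (exp (- c * real k)) * indicator (cball 0 (real k + 1)) x"
      using k assms by (simp add: ennreal_leI)
    also have "\<dots> \<le> (\<Sum>k. ennreal (exp (- c * real k)) * indicator (cball 0 (real k + 1)) x)"
      using sum_le_suminf[of "\<lambda>k. ennreal (exp (- c * real k)) * indicator (cball 0 (real k + 1)) x" "{k}"]
      by (simp del: sum_indicator_mult sum_mult_indicator)
    finally show "ennreal (exp (- c * norm x))
      \<le> (\<Sum>k. ennreal (exp (- c * real k)) * indicator (cball 0 (real k + 1)) x)" .
  qed
  also have "\<dots> = (\<Sum>k. ennreal (exp (- c * real k)) * emeasure lborel (cball (0 :: 'a) (real k + 1)))"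
    by (subst nn_integral_suminf)
      (auto simp: nn_integral_cmult_indicator intro!: borel_measurable_times_ennreal borel_measurable_indicator)
  also have "\<dots> = (\<Sum>k. ennreal (b k))"
    by (simp add: emeasure_cball b_def d_def ennreal_mult)
  also have "\<dots> = ennreal (\<Sum>k. b k)"
    by (intro suminf_ennreal2 b) (simp add: b_def)
  finally show ?thesis by (simp add: le_less_trans)
qed

theorem theorem3p1:
  fixes u :: "real^'m::finite \<Rightarrow> real^'n::finite"
    and M P :: "('m, 'n) pseudo set"
    and a :: "'m \<Rightarrow> ('m, 'n) pseudo"
    and z w :: "('m, 'n) pseudo \<Rightarrow> real"
  assumes "smooth u"
    and "M = entire_graph u"
    and "spacelike M"
    and "0 \<in> M"
    and "spacelike_plane P"
    and "orthonormal_basis P a"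
    and "z = (\<lambda>p. pinner p p)"
    and "w = w_function M a"
  shows "Limsup at_top (\<lambda>R::real. ennreal (inverse (R ^ (2 * CARD('m)))) *
           (\<integral>\<^sup>+ p \<in> {p. z p \<le> R\<^sup>2} \<inter> M. ennreal (w p) \<partial>riemannian_volume u)) < \<infinity>
       \<and> (\<forall>\<alpha>>0. (\<integral>\<^sup>+ p \<in> M. ennreal (w p * exp (- \<alpha> * z p)) \<partial>riemannian_volume u) < \<infinity>)"
proof -
  have sp: "spacelike (entire_graph u)" using assms(2,3) by simp
  have u0: "u 0 = 0"
    using assms(2,4) by (auto simp: entire_graph_def graph_map_def zero_prod_def)
  obtain C where C: "C \<ge> 0" "\<And>F. F \<in> borel_measurable borel \<Longrightarrow>
      (\<integral>\<^sup>+p\<in>M. ennreal (w p) * F p \<partial>riemannian_volume u)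
        \<le> ennreal C * (\<integral>\<^sup>+x. F (graph_map u x) \<partial>lborel)"
    using nn_integral_w_function_le[OF \<open>smooth u\<close> sp, of a thesis] assms(2,8) by auto
  obtain \<delta> where \<delta>: "\<delta> > 0" "\<And>x. z (graph_map u x) \<ge> 2 * \<delta> * (norm x - 1)"
    using spacelike_graph_pinner_growth[OF sp smooth_differentiable[OF \<open>smooth u\<close>] u0]
      \<open>z = _\<close> by blast
  have "continuous_on UNIV z"
    unfolding \<open>z = _\<close> pinner_eq_inner by (intro continuous_intros)
  then have [measurable]: "z \<in> borel_measurable borel"
    by (rule borel_measurable_continuous_onI)
  \<comment> \<open>The growth bound and \<open>z \<le> R\<^sup>2\<close> give
    \<open>norm x \<le> 1 + R\<^sup>2 / (2 * \<delta>)\<close>. For \<open>R \<ge> 1\<close> the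
    summand 1 is at most \<open>R\<^sup>2\<close>, whence the radius \<open>K * R\<^sup>2\<close>,
    and \<open>V\<close> times \<open>R ^ (2 * CARD('m))\<close> is the volume of that ball.\<close>
  define K where "K = 1 + 1 / (2 * \<delta>)"
  define V where "V = unit_ball_vol CARD('m) * K ^ CARD('m)"
  have K: "K \<ge> 0" and V: "V \<ge> 0" using \<delta>(1) by (simp_all add: K_def V_def)
  have bound: "ennreal (inverse (R ^ (2 * CARD('m)))) *
      (\<integral>\<^sup>+ p \<in> {p. z p \<le> R\<^sup>2} \<inter> M. ennreal (w p) \<partial>riemannian_volume u) \<le> ennreal (C * V)"
    if R: "R \<ge> 1" for R :: real
  proof -
    have "norm x \<le> K * R\<^sup>2" if "z (graph_map u x) \<le> R\<^sup>2" for x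
    proof -
      have "2 * \<delta> * (norm x - 1) \<le> R\<^sup>2" using \<delta>(2)[of x] that by linarith
      then have "norm x \<le> 1 + R\<^sup>2 / (2 * \<delta>)" using \<delta>(1) by (simp add: field_simps)
      also have "\<dots> \<le> R\<^sup>2 + R\<^sup>2 / (2 * \<delta>)" using R by simp
      finally show ?thesis by (simp add: K_def algebra_simps)
    qed
    then have sub: "indicator {p. z p \<le> R\<^sup>2} (graph_map u x) \<le> (indicator (cball 0 (K * R\<^sup>2)) x :: ennreal)"
      for x by (simp add: indicator_def)
    have "(\<integral>\<^sup>+ p \<in> {p. z p \<le> R\<^sup>2} \<inter> M. ennreal (w p) \<partial>riemannian_volume u)
        = (\<integral>\<^sup>+ p \<in> M. ennreal (w p) * indicator {p. z p \<le> R\<^sup>2} p \<partial>riemannian_volume u)"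
      by (simp add: indicator_inter_arith mult.assoc)
    also have "\<dots> \<le> ennreal C * (\<integral>\<^sup>+x. indicator {p. z p \<le> R\<^sup>2} (graph_map u x) \<partial>lborel)"
      by (rule C(2)) measurable
    also have "\<dots> \<le> ennreal C * (\<integral>\<^sup>+x. indicator (cball (0 :: real^'m) (K * R\<^sup>2)) x \<partial>lborel)"
      by (intro mult_left_mono nn_integral_mono sub) auto
    also have "\<dots> = ennreal (C * V * R ^ (2 * CARD('m)))"
      using K C(1) by (simp add: emeasure_cball V_def ennreal_mult'' power_mult_distrib
          power_mult[symmetric] ennreal_mult mult.assoc)
    finally have "ennreal (inverse (R ^ (2 * CARD('m)))) *
      (\<integral>\<^sup>+ p \<in> {p. z p \<le> R\<^sup>2} \<inter> M. ennreal (w p) \<partial>riemannian_volume u)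
        \<le> ennreal (inverse (R ^ (2 * CARD('m)))) * ennreal (C * V * R ^ (2 * CARD('m)))"
      by (rule mult_left_mono) simp
    also have "\<dots> = ennreal (C * V)"
      using R C(1) V by (subst ennreal_mult[symmetric]) (auto simp: field_simps)
    finally show ?thesis .
  qed
  then have "Limsup at_top (\<lambda>R::real. ennreal (inverse (R ^ (2 * CARD('m)))) *
           (\<integral>\<^sup>+ p \<in> {p. z p \<le> R\<^sup>2} \<inter> M. ennreal (w p) \<partial>riemannian_volume u)) \<le> ennreal (C * V)"
    by (intro Limsup_bounded eventually_at_top_linorderI[of 1])
  then have "Limsup at_top (\<lambda>R::real. ennreal (inverse (R ^ (2 * CARD('m)))) *
           (\<integral>\<^sup>+ p \<in> {p. z p \<le> R\<^sup>2} \<inter> M. ennreal (w p) \<partial>riemannian_volume u)) < \<infinity>"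
    by (rule le_less_trans) simp
  moreover have "(\<integral>\<^sup>+ p \<in> M. ennreal (w p * exp (- \<alpha> * z p)) \<partial>riemannian_volume u) < \<infinity>"
    if \<alpha>: "\<alpha> > 0" for \<alpha>
  proof -
    \<comment> \<open>The growth bound multiplied by \<alpha> gives decay at rate \<open>c\<close>
      in \<open>norm x\<close>; the constant factor \<open>exp c\<close> accounts for the shift by 1
      in that bound.\<close>
    define c where "c = 2 * \<delta> * \<alpha>"
    have c: "c > 0" using \<alpha> \<delta>(1) by (simp add: c_def)
    have "(\<integral>\<^sup>+ p \<in> M. ennreal (w p * exp (- \<alpha> * z p)) \<partial>riemannian_volume u)
        = (\<integral>\<^sup>+ p \<in> M. ennreal (w p) * ennreal (exp (- \<alpha> * z p)) \<partial>riemannian_volume u)"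
      by (simp add: ennreal_mult'')
    also have "\<dots> \<le> ennreal C * (\<integral>\<^sup>+x. ennreal (exp (- \<alpha> * z (graph_map u x))) \<partial>lborel)"
      by (rule C(2)) measurable
    also have "\<dots> \<le> ennreal C * (\<integral>\<^sup>+x. ennreal (exp c) * ennreal (exp (- c * norm (x :: real^'m))) \<partial>lborel)"
    proof (intro mult_left_mono nn_integral_mono)
      fix x :: "real^'m"
      have "- \<alpha> * z (graph_map u x) \<le> c + - c * norm x"
        using mult_left_mono[OF \<delta>(2)[of x], of \<alpha>] \<alpha> by (simp add: c_def algebra_simps)
      then show "ennreal (exp (- \<alpha> * z (graph_map u x))) \<le> ennreal (exp c) * ennreal (exp (- c * norm x))"
        by (simp add: ennreal_mult''[symmetric] exp_add[symmetric] ennreal_leI)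
    qed simp
    also have "\<dots> = ennreal C * (ennreal (exp c) * (\<integral>\<^sup>+x. ennreal (exp (- c * norm (x :: real^'m))) \<partial>lborel))"
      by (subst nn_integral_cmult) auto
    also have "\<dots> < \<infinity>"
      using nn_integral_exp_norm_finite[OF c, where 'a = "real^'m"]
      by (auto intro!: ennreal_mult_less_top[THEN iffD2])
    finally show ?thesis .
  qed
  ultimately show ?thesis by blast
qed

end
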